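(* Let $n\ge1$. For any shortened polar code obtained from the polar code of length $2^n$, with index set $\mathcal{U}_s\subseteq\mathbb{Z}_{2^n}$ of shortened encoder input bits and index set $\mathcal{X}_s\subseteq\mathbb{Z}_{2^n}$ of the corresponding fixed encoder output bits, we have $\mathcal{U}_s=\mathcal{X}_s$.
   Context: Let $\mathbb{Z}_{2^n}=\{0,1,\ldots,2^n-1\}$. The polar code of length $2^n$ encodes $\mathbf{u}\in\mathbb{F}_2^{2^n}$ to $\mathbf{x}=\mathbf{u}\left[\begin{smallmatrix}1&0\\1&1\end{smallmatrix}\right]^{\otimes n}$ (rows and columns indexed by $\mathbb{Z}_{2^n}$ in the natural order). Shortening the input bits with indices in $\mathcal{U}_s$ means setting $u_i=0$ for all $i\in\mathcal{U}_s$. The output bit $x_j$ is fixed (to zero) if $x_j=0$ for every $\mathbf{u}\in\mathbb{F}_2^{2^n}$ with $u_i=0$ for all $i\in\mathcal{U}_s$; $\mathcal{X}_s$ is the set of all $j$ such that $x_j$ is fixed. In a shortened polar code, the $J$ shortened input bits are chosen so that exactly $J$ output bits are fixed, i.e. $|\mathcal{X}_s|=|\mathcal{U}_s|$. *)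

theory Defs
  imports "Jordan_Normal_Form.Matrix" "HOL-Library.Z2"
begin

definition kronecker_mat :: "'a::semiring_1 mat \<Rightarrow> 'a mat \<Rightarrow> 'a mat" where
  "kronecker_mat A B = mat (dim_row A * dim_row B) (dim_col A * dim_col B)
     (\<lambda>(i, j). A $$ (i div dim_row B, j div dim_col B) * B $$ (i mod dim_row B, j mod dim_col B))"

fun kronecker_power :: "'a::semiring_1 mat \<Rightarrow> nat \<Rightarrow> 'a mat" where
  "kronecker_power A 0 = 1\<^sub>m 1"
| "kronecker_power A (Suc n) = kronecker_mat A (kronecker_power A n)"

definition polar_kernel :: "bit mat" where
  "polar_kernel = mat_of_rows_list 2 [[1, 0], [1, 1]]"

definition polar_matrix :: "nat \<Rightarrow> bit mat" where
  "polar_matrix n = kronecker_power polar_kernel n"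

lemma polar_matrix_carrier [simp]: "polar_matrix n \<in> carrier_mat (2 ^ n) (2 ^ n)"
  by (induction n)
    (auto simp: polar_matrix_def kronecker_mat_def polar_kernel_def mat_of_rows_list_def)

text \<open>The encoder multiplies by the matrix from the right, treating its input as a row vector.\<close>

definition polar_encode :: "nat \<Rightarrow> bit vec \<Rightarrow> bit vec" where
  "polar_encode n u = vec (2 ^ n) (\<lambda>j. u \<bullet> col (polar_matrix n) j)"

definition shortened_inputs :: "nat \<Rightarrow> nat set \<Rightarrow> bit vec set" where
  "shortened_inputs n U = {u \<in> carrier_vec (2 ^ n). \<forall>i\<in>U. u $ i = 0}"

definition fixed_outputs :: "nat \<Rightarrow> nat set \<Rightarrow> nat set" where
  "fixed_outputs n U = {j \<in> {0..<2 ^ n}. \<forall>u\<in>shortened_inputs n U. polar_encode n u $ j = 0}"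

definition shortened_polar_code :: "nat \<Rightarrow> nat set \<Rightarrow> nat set \<Rightarrow> bool" where
  "shortened_polar_code n U X \<longleftrightarrow>
     U \<subseteq> {0..<2 ^ n} \<and> X = fixed_outputs n U \<and> card X = card U"

end

theory Submission
  imports Defs
begin

text \<open>The polar matrix has ones on its diagonal, so a fixed output \<open>x\<^sub>j\<close> forces \<open>u\<^sub>j\<close> to be
  shortened (otherwise the \<open>j\<close>-th unit vector is an admissible input with \<open>x\<^sub>j = 1\<close>). Hence the
  fixed outputs are a subset of the shortened inputs, and equal cardinality gives equality.\<close>

lemma kronecker_power_carrier:
  assumes "A \<in> carrier_mat m m"
  shows "kronecker_power A n \<in> carrier_mat (m ^ n) (m ^ n)"
  using assms by (induction n) (auto simp: kronecker_mat_def)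

text \<open>Row and column indices split by the same \<open>div\<close> and \<open>mod\<close>, so a
  diagonal entry of a Kronecker product is a product of diagonal entries of the factors.\<close>

lemma kronecker_power_diag:
  assumes A: "A \<in> carrier_mat m m" and diag: "\<And>i. i < m \<Longrightarrow> A $$ (i, i) = 1"
    and "j < m ^ n"
  shows "kronecker_power A n $$ (j, j) = 1"
  using \<open>j < m ^ n\<close>
proof (induction n arbitrary: j)
  case 0
  then show ?case by simp
next
  case (Suc n)
  \<comment> \<open>The bound on \<open>j\<close> excludes \<open>m = 0\<close>, so the remainder
    modulo \<open>m ^ n\<close> is a valid index.\<close>
  have pos: "m ^ n > 0"
    using Suc.prems by (auto intro: gr0I)
  then have "j mod m ^ n < m ^ n" "j div m ^ n < m"
    using Suc.prems by (simp_all add: less_mult_imp_div_less)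
  then show ?case
    using A kronecker_power_carrier[OF A, of n] Suc by (simp add: kronecker_mat_def diag)
qed

lemma polar_matrix_diag:
  assumes "j < 2 ^ n"
  shows "polar_matrix n $$ (j, j) = 1"
  unfolding polar_matrix_def
proof (rule kronecker_power_diag[OF _ _ assms])
  show "polar_kernel \<in> carrier_mat 2 2"
    by (rule carrier_matI) (simp_all add: polar_kernel_def mat_of_rows_list_def)
  show "polar_kernel $$ (i, i) = 1" if "i < 2" for i
    using that by (auto simp: polar_kernel_def mat_of_rows_list_def less_2_cases_iff)
qed

lemma polar_encode_unit_vec:
  assumes "i < 2 ^ n" "j < 2 ^ n"
  shows "polar_encode n (unit_vec (2 ^ n) i) $ j = polar_matrix n $$ (i, j)"
proof -
  have G: "polar_matrix n \<in> carrier_mat (2 ^ n) (2 ^ n)"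
    by (rule polar_matrix_carrier)
  then have "col (polar_matrix n) j \<in> carrier_vec (2 ^ n)"
    by (rule col_carrier_vec[OF assms(2)])
  then have "unit_vec (2 ^ n) i \<bullet> col (polar_matrix n) j = col (polar_matrix n) j $ i"
    using assms(1) by (rule scalar_prod_left_unit)
  also have "\<dots> = polar_matrix n $$ (i, j)"
    using assms by (intro index_col) (simp_all only: carrier_matD[OF G])
  finally show ?thesis
    using assms(2) unfolding polar_encode_def by (simp only: index_vec)
qed

lemma fixed_outputs_subset:
  assumes "U \<subseteq> {0..<2 ^ n}"
  shows "fixed_outputs n U \<subseteq> U"
proof (rule subsetI, rule ccontr)
  fix j assume fixed: "j \<in> fixed_outputs n U" and "j \<notin> U"
  from fixed have j: "j < 2 ^ n" by (simp add: fixed_outputs_def)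
  \<comment> \<open>The bound on \<open>U\<close> matters: entries of \<open>unit_vec\<close> are
    specified only at indices below its dimension.\<close>
  have "unit_vec (2 ^ n) j \<in> shortened_inputs n U"
    using assms j \<open>j \<notin> U\<close> by (auto simp: shortened_inputs_def)
  with fixed have "polar_encode n (unit_vec (2 ^ n) j) $ j = 0"
    by (simp add: fixed_outputs_def)
  with j show False
    by (simp add: polar_encode_unit_vec polar_matrix_diag)
qed

theorem corollary18:
  fixes n :: nat and U X :: "nat set"
  assumes "n \<ge> 1"
    and "shortened_polar_code n U X"
  shows "U = X"
proof -
  have U: "U \<subseteq> {0..<2 ^ n}" and X: "X = fixed_outputs n U" and "card X = card U"
    using assms(2) unfolding shortened_polar_code_def by blast+
  \<comment> \<open>A subset of equal cardinality is the whole set only in the finite case, as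
    \<open>card\<close> is 0 on infinite sets.\<close>
  moreover have "finite U"
    using U by (rule finite_subset) simp
  ultimately show ?thesis
    using card_subset_eq[of U X] fixed_outputs_subset[OF U] by simp
qed

end
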